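(* For every set $O$ of ordinals, the category $\mathbf{SMonogr}_O$ is finitely complete. The categories $\mathbf{Monogr}$, $\mathbf{SMonogr}$ and $\mathbf{FMonogr}$ are not finitely complete.
   Context: A monograph is a set $A$ of ordered pairs which is a functional relation with domain some set $E$ (the set of edges of $A$, written $\mathrm{E}_A$) such that for every $x\in E$, $A(x)$ is an $E$-sequence, i.e. a function $A(x):\lambda\to E$ for some ordinal $\lambda$; $\lambda$ is the length $|x|$ of $x$, and $x_\iota$ denotes $A(x)(\iota)$ for $\iota<|x|$. A node is an edge of length $0$. $A$ is standard if every edge occurring in some $A(x)$ is a node. For a set $O$ of ordinals, $A$ is an $O$-monograph if $|x|\in O$ for all edges $x$. A morphism $f:A\to B$ is a function $f:\mathrm{E}_A\to\mathrm{E}_B$ with $|f(x)|=|x|$ and $f(x_\iota)=f(x)_\iota$ for all $x$ and $\iota<|x|$. $\mathbf{Monogr}$ is the category of monographs and morphisms; $\mathbf{SMonogr}$, $\mathbf{SMonogr}_O$ and $\mathbf{FMonogr}$ are its full subcategories of standard monographs, standard $O$-monographs, and finite $\omega$-monographs (finitely many edges, all of finite length). *)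

theory Defs
  imports Complex_Main "HOL-Library.Countable_Set_Type"
begin

section \<open>The ambient universe of sets\<close>

text \<open>
  Monographs form a large category: the statement distinguishes sets of ordinals from the
  proper class of all ordinals. The ambient set theory is therefore made explicit as a type whose
  elements are the sets: \<^term>\<open>x \<in> elts y\<close> is membership, a value of type \<^typ>\<open>'a set\<close> is a class,
  and such a class is a set iff it lies in \<^term>\<open>range elts\<close>. The axioms are those of second-order
  ZFC, except that the power set axiom is not required (pairing follows from \<open>infinity\<close>, choice
  from \<open>replacement\<close> and choice in HOL). So every second-order model of ZFC is an instance; and,
  unlike for full ZFC, the existence of an instance is provable in HOL (see below).
\<close>

class set_universe =
  fixes elts :: "'a \<Rightarrow> 'a set"
  assumes extensionality: "elts x = elts y \<Longrightarrow> x = y"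
    and separation: "X \<subseteq> elts x \<Longrightarrow> X \<in> range elts"
    and union: "(\<Union>y\<in>elts x. elts y) \<in> range elts"
    and replacement: "f ` elts x \<in> range elts"
    and infinity: "range (g :: nat \<Rightarrow> 'a) \<in> range elts"
    and foundation: "wf {(x, y). x \<in> elts y}"

text \<open>The hereditarily countable sets are an instance.\<close>

datatype hc = HC (hc_elts: "hc cset")

instantiation hc :: set_universe
begin

definition elts_hc :: "hc \<Rightarrow> hc set" where
  "elts_hc x = rcset (hc_elts x)"

lemma range_elts_hc: "X \<in> range (elts :: hc \<Rightarrow> hc set) \<longleftrightarrow> countable X"
proof
  assume "X \<in> range (elts :: hc \<Rightarrow> hc set)"
  then show "countable X" by (auto simp: elts_hc_def)
next
  assume "countable X"
  then have "elts (HC (acset X)) = X" by (simp add: elts_hc_def)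
  then show "X \<in> range (elts :: hc \<Rightarrow> hc set)" by (metis rangeI)
qed

instance
proof
  fix x y :: hc and X and f :: "hc \<Rightarrow> hc" and g :: "nat \<Rightarrow> hc"
  have c: "countable (elts z)" for z :: hc using range_elts_hc by blast
  show "elts x = elts y \<Longrightarrow> x = y"
    by (metis elts_hc_def hc.exhaust_sel rcset_inject)
  show "X \<subseteq> elts x \<Longrightarrow> X \<in> range elts"
    using c countable_subset by (auto simp: range_elts_hc)
  show "(\<Union>y\<in>elts x. elts y) \<in> range elts"
    using c by (simp add: range_elts_hc)
  show "f ` elts x \<in> range elts"
    using c by (simp add: range_elts_hc)
  show "range g \<in> range elts"
    by (simp add: range_elts_hc)
  show "wf {(x :: hc, y). x \<in> elts y}"
  proof (rule wfUNIVI)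
    fix P :: "hc \<Rightarrow> bool" and z :: hc
    assume "\<forall>x. (\<forall>y. (y, x) \<in> {(x, y). x \<in> elts y} \<longrightarrow> P y) \<longrightarrow> P x"
    then show "P z"
      by (induction z) (auto simp: elts_hc_def)
  qed
qed

end


subsection \<open>Sets, ordered pairs, functions\<close>

text \<open>\<open>mkset X\<close> is meaningful only if the class \<open>X\<close> is a set.\<close>

definition mkset :: "'v::set_universe set \<Rightarrow> 'v" where
  "mkset X = (THE x. elts x = X)"

definition opair :: "'v::set_universe \<Rightarrow> 'v \<Rightarrow> 'v" where
  "opair a b = mkset {mkset {a}, mkset {a, b}}"

definition is_function :: "'v::set_universe \<Rightarrow> bool" where
  "is_function f \<longleftrightarrow>
     (\<forall>p\<in>elts f. \<exists>x y. p = opair x y) \<and>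
     (\<forall>x y z. opair x y \<in> elts f \<longrightarrow> opair x z \<in> elts f \<longrightarrow> y = z)"

definition dom_set :: "'v::set_universe \<Rightarrow> 'v" where
  "dom_set f = mkset {x. \<exists>y. opair x y \<in> elts f}"

definition app :: "'v::set_universe \<Rightarrow> 'v \<Rightarrow> 'v" where
  "app f x = (THE y. opair x y \<in> elts f)"

definition function_from_to :: "'v::set_universe \<Rightarrow> 'v \<Rightarrow> 'v \<Rightarrow> bool" where
  "function_from_to f X Y \<longleftrightarrow>
     is_function f \<and> dom_set f = X \<and> (\<forall>x\<in>elts X. app f x \<in> elts Y)"

definition lam :: "'v::set_universe \<Rightarrow> ('v \<Rightarrow> 'v) \<Rightarrow> 'v" where
  "lam X h = mkset ((\<lambda>x. opair x (h x)) ` elts X)"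

lemma elts_mkset: "X \<in> range elts \<Longrightarrow> elts (mkset X) = X"
  unfolding mkset_def by (rule theI') (auto intro: extensionality)

lemma pair_in_range: "{a, b} \<in> range (elts :: 'v::set_universe \<Rightarrow> 'v set)"
proof -
  have "range (\<lambda>n::nat. if n = 0 then a else b) = {a, b}" by auto
  then show ?thesis using infinity by metis
qed

lemma empty_in_range: "{} \<in> range (elts :: 'v::set_universe \<Rightarrow> 'v set)"
  using separation[of "{}"] by blast

lemma elts_mkset_pair [simp]: "elts (mkset {a, b}) = {a, b :: 'v::set_universe}"
  by (rule elts_mkset[OF pair_in_range])

lemma elts_mkset_singleton [simp]: "elts (mkset {a}) = {a :: 'v::set_universe}"
  using elts_mkset_pair[of a a] by simp

lemma elts_mkset_empty [simp]: "elts (mkset {}) = ({} :: 'v::set_universe set)"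
  by (rule elts_mkset[OF empty_in_range])

lemma opair_inject [simp]: "opair a b = opair c d \<longleftrightarrow> a = c \<and> b = d"
proof
  assume "opair a b = opair c d"
  then have "{mkset {a}, mkset {a, b}} = {mkset {c}, mkset {c, d}}"
    unfolding opair_def by (metis elts_mkset_pair)
  then have "elts ` {mkset {a}, mkset {a, b}} = elts ` {mkset {c}, mkset {c, d}}"
    by (rule arg_cong)
  then have "{{a}, {a, b}} = {{c}, {c, d}}" by simp
  then show "a = c \<and> b = d" by (auto simp: doubleton_eq_iff)
qed simp

lemma elts_dom_set: "elts (dom_set f) = {x. \<exists>y. opair x y \<in> elts f}"
proof -
  let ?fst = "\<lambda>p. SOME x. \<exists>y. p = opair x y"
  have "?fst (opair x y) = x" for x y :: 'a by (rule some_equality) auto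
  then have "{x. \<exists>y. opair x y \<in> elts f} \<subseteq> ?fst ` elts f" by force
  moreover obtain z where "elts z = ?fst ` elts f" using replacement by (metis rangeE)
  ultimately have "{x. \<exists>y. opair x y \<in> elts f} \<in> range elts" using separation by metis
  then show ?thesis unfolding dom_set_def by (rule elts_mkset)
qed

lemma elts_lam: "elts (lam X h) = (\<lambda>x. opair x (h x)) ` elts X"
  unfolding lam_def by (rule elts_mkset[OF replacement])

lemma is_function_lam [simp]: "is_function (lam X h)"
  by (auto simp: is_function_def elts_lam)

lemma dom_set_lam [simp]: "dom_set (lam X h) = X"
  by (rule extensionality) (auto simp: elts_dom_set elts_lam)

lemma app_lam [simp]: "x \<in> elts X \<Longrightarrow> app (lam X h) x = h x"
  unfolding app_def by (rule the_equality) (auto simp: elts_lam)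

lemma function_eta: "is_function f \<Longrightarrow> lam (dom_set f) (app f) = f"
proof (rule extensionality)
  assume f: "is_function f"
  have app: "app f x = y" if "opair x y \<in> elts f" for x y
    unfolding app_def using f that by (auto simp: is_function_def)
  show "elts (lam (dom_set f) (app f)) = elts f"
  proof
    show "elts (lam (dom_set f) (app f)) \<subseteq> elts f"
      by (auto simp: elts_lam elts_dom_set app)
    show "elts f \<subseteq> elts (lam (dom_set f) (app f))"
    proof
      fix p assume p: "p \<in> elts f"
      then obtain x y where "p = opair x y" using f by (auto simp: is_function_def)
      then show "p \<in> elts (lam (dom_set f) (app f))"
        using p by (auto simp: elts_lam elts_dom_set app image_iff)
    qed
  qed
qed


subsection \<open>Ordinals\<close>

definition is_ordinal :: "'v::set_universe \<Rightarrow> bool" where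
  "is_ordinal \<alpha> \<longleftrightarrow>
     (\<forall>\<beta>\<in>elts \<alpha>. elts \<beta> \<subseteq> elts \<alpha>) \<and>
     well_order_on (elts \<alpha>)
       {(\<beta>, \<gamma>). \<beta> \<in> elts \<alpha> \<and> \<gamma> \<in> elts \<alpha> \<and> (\<beta> \<in> elts \<gamma> \<or> \<beta> = \<gamma>)}"

primrec numeral_set :: "nat \<Rightarrow> 'v::set_universe" where
  "numeral_set 0 = mkset {}"
| "numeral_set (Suc n) = mkset (insert (numeral_set n) (elts (numeral_set n)))"

definition omega :: "'v::set_universe" where
  "omega = mkset (range numeral_set)"


section \<open>Categories and finite completeness\<close>

record ('o, 'm) category =
  Obj :: "'o set"
  Arr :: "'m set"
  Dom :: "'m \<Rightarrow> 'o"
  Cod :: "'m \<Rightarrow> 'o"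
  Ide :: "'o \<Rightarrow> 'm"
  Comp :: "'m \<Rightarrow> 'm \<Rightarrow> 'm"

definition hom :: "('o, 'm) category \<Rightarrow> 'o \<Rightarrow> 'o \<Rightarrow> 'm set" where
  "hom C a b = {f \<in> Arr C. Dom C f = a \<and> Cod C f = b}"

definition is_category :: "('o, 'm) category \<Rightarrow> bool" where
  "is_category C \<longleftrightarrow>
     (\<forall>f\<in>Arr C. Dom C f \<in> Obj C \<and> Cod C f \<in> Obj C) \<and>
     (\<forall>a\<in>Obj C. Ide C a \<in> hom C a a) \<and>
     (\<forall>f\<in>Arr C. \<forall>g\<in>Arr C. Cod C f = Dom C g \<longrightarrow>
        Comp C g f \<in> hom C (Dom C f) (Cod C g)) \<and>
     (\<forall>f\<in>Arr C. Comp C f (Ide C (Dom C f)) = f \<and> Comp C (Ide C (Cod C f)) f = f) \<and>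
     (\<forall>f\<in>Arr C. \<forall>g\<in>Arr C. \<forall>h\<in>Arr C. Cod C f = Dom C g \<longrightarrow> Cod C g = Dom C h \<longrightarrow>
        Comp C h (Comp C g f) = Comp C (Comp C h g) f)"

definition full_subcategory ::
    "('o, 'm) category \<Rightarrow> ('o \<Rightarrow> bool) \<Rightarrow> ('o, 'm) category" where
  "full_subcategory C P =
     C\<lparr>Obj := {a \<in> Obj C. P a}, Arr := {f \<in> Arr C. P (Dom C f) \<and> P (Cod C f)}\<rparr>"

definition is_functor ::
    "('i, 'j) category \<Rightarrow> ('o, 'm) category \<Rightarrow> ('i \<Rightarrow> 'o) \<Rightarrow> ('j \<Rightarrow> 'm) \<Rightarrow> bool" where
  "is_functor J C F\<^sub>o F\<^sub>m \<longleftrightarrow>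
     (\<forall>i\<in>Obj J. F\<^sub>o i \<in> Obj C) \<and>
     (\<forall>u\<in>Arr J. F\<^sub>m u \<in> hom C (F\<^sub>o (Dom J u)) (F\<^sub>o (Cod J u))) \<and>
     (\<forall>i\<in>Obj J. F\<^sub>m (Ide J i) = Ide C (F\<^sub>o i)) \<and>
     (\<forall>u\<in>Arr J. \<forall>v\<in>Arr J. Cod J u = Dom J v \<longrightarrow>
        F\<^sub>m (Comp J v u) = Comp C (F\<^sub>m v) (F\<^sub>m u))"

definition is_cone ::
    "('i, 'j) category \<Rightarrow> ('o, 'm) category \<Rightarrow> ('i \<Rightarrow> 'o) \<Rightarrow> ('j \<Rightarrow> 'm) \<Rightarrow>
     'o \<Rightarrow> ('i \<Rightarrow> 'm) \<Rightarrow> bool" where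
  "is_cone J C F\<^sub>o F\<^sub>m L p \<longleftrightarrow>
     L \<in> Obj C \<and>
     (\<forall>i\<in>Obj J. p i \<in> hom C L (F\<^sub>o i)) \<and>
     (\<forall>u\<in>Arr J. Comp C (F\<^sub>m u) (p (Dom J u)) = p (Cod J u))"

definition is_limit ::
    "('i, 'j) category \<Rightarrow> ('o, 'm) category \<Rightarrow> ('i \<Rightarrow> 'o) \<Rightarrow> ('j \<Rightarrow> 'm) \<Rightarrow>
     'o \<Rightarrow> ('i \<Rightarrow> 'm) \<Rightarrow> bool" where
  "is_limit J C F\<^sub>o F\<^sub>m L p \<longleftrightarrow>
     is_cone J C F\<^sub>o F\<^sub>m L p \<and>
     (\<forall>L' p'. is_cone J C F\<^sub>o F\<^sub>m L' p' \<longrightarrow>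
        (\<exists>!h. h \<in> hom C L' L \<and> (\<forall>i\<in>Obj J. Comp C (p i) h = p' i)))"

text \<open>
  Every finite category is isomorphic to one whose objects and arrows are natural numbers, so it
  suffices to let \<open>J\<close> range over the latter.
\<close>

definition finitely_complete :: "('o, 'm) category \<Rightarrow> bool" where
  "finitely_complete C \<longleftrightarrow>
     (\<forall>J :: (nat, nat) category. \<forall>F\<^sub>o F\<^sub>m.
        is_category J \<and> finite (Obj J) \<and> finite (Arr J) \<and> is_functor J C F\<^sub>o F\<^sub>m \<longrightarrow>
        (\<exists>L p. is_limit J C F\<^sub>o F\<^sub>m L p))"

lemma is_category_full_subcategory:
  "is_category C \<Longrightarrow> is_category (full_subcategory C P)"
  unfolding is_category_def full_subcategory_def hom_def by auto


section \<open>Monographs\<close>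

definition is_sequence :: "'v::set_universe \<Rightarrow> 'v \<Rightarrow> bool" where
  "is_sequence E s \<longleftrightarrow> (\<exists>\<alpha>. is_ordinal \<alpha> \<and> function_from_to s \<alpha> E)"

definition is_monograph :: "'v::set_universe \<Rightarrow> bool" where
  "is_monograph A \<longleftrightarrow> is_function A \<and> (\<forall>x\<in>elts (dom_set A). is_sequence (dom_set A) (app A x))"

definition edges :: "'v::set_universe \<Rightarrow> 'v" where
  "edges A = dom_set A"

definition len :: "'v::set_universe \<Rightarrow> 'v \<Rightarrow> 'v" where
  "len A x = dom_set (app A x)"

text \<open>\<open>nth_edge A x \<iota>\<close> is the edge $x_\iota$.\<close>

definition nth_edge :: "'v::set_universe \<Rightarrow> 'v \<Rightarrow> 'v \<Rightarrow> 'v" where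
  "nth_edge A x \<iota> = app (app A x) \<iota>"

definition is_node :: "'v::set_universe \<Rightarrow> 'v \<Rightarrow> bool" where
  "is_node A x \<longleftrightarrow> x \<in> elts (edges A) \<and> len A x = numeral_set 0"

definition is_standard :: "'v::set_universe \<Rightarrow> bool" where
  "is_standard A \<longleftrightarrow> (\<forall>x\<in>elts (edges A). \<forall>\<iota>\<in>elts (len A x). is_node A (nth_edge A x \<iota>))"

definition lengths_in :: "'v::set_universe \<Rightarrow> 'v \<Rightarrow> bool" where
  "lengths_in S A \<longleftrightarrow> (\<forall>x\<in>elts (edges A). len A x \<in> elts S)"

definition is_morphism :: "'v::set_universe \<Rightarrow> 'v \<Rightarrow> 'v \<Rightarrow> bool" where
  "is_morphism A B f \<longleftrightarrow>
     function_from_to f (edges A) (edges B) \<and>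
     (\<forall>x\<in>elts (edges A).
        len B (app f x) = len A x \<and>
        (\<forall>\<iota>\<in>elts (len A x). app f (nth_edge A x \<iota>) = nth_edge B (app f x) \<iota>))"

text \<open>An arrow is a triple \<open>(A, f, B)\<close>, so that it determines its codomain.\<close>

definition Monogr :: "('v::set_universe, 'v \<times> 'v \<times> 'v) category" where
  "Monogr =
     \<lparr>Obj = {A. is_monograph A},
      Arr = {(A, f, B). is_monograph A \<and> is_monograph B \<and> is_morphism A B f},
      Dom = (\<lambda>(A, f, B). A),
      Cod = (\<lambda>(A, f, B). B),
      Ide = (\<lambda>A. (A, lam (edges A) (\<lambda>x. x), A)),
      Comp = (\<lambda>(_, g, C) (A, f, _). (A, lam (edges A) (\<lambda>x. app g (app f x)), C))\<rparr>"

definition SMonogr :: "('v::set_universe, 'v \<times> 'v \<times> 'v) category" where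
  "SMonogr = full_subcategory Monogr is_standard"

definition SMonogr_in :: "'v::set_universe \<Rightarrow> ('v, 'v \<times> 'v \<times> 'v) category" where
  "SMonogr_in S = full_subcategory Monogr (\<lambda>A. is_standard A \<and> lengths_in S A)"

definition FMonogr :: "('v::set_universe, 'v \<times> 'v \<times> 'v) category" where
  "FMonogr = full_subcategory Monogr (\<lambda>A. finite (elts (edges A)) \<and> lengths_in omega A)"

lemma nth_edge_in_edges:
  assumes "is_monograph A" "x \<in> elts (edges A)" "\<iota> \<in> elts (len A x)"
  shows "nth_edge A x \<iota> \<in> elts (edges A)"
  using assms
  by (auto simp: is_monograph_def is_sequence_def function_from_to_def edges_def len_def nth_edge_def)

lemma lam_cong: "(\<And>x. x \<in> elts X \<Longrightarrow> h x = k x) \<Longrightarrow> lam X h = lam X k"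
  by (rule extensionality) (auto simp: elts_lam image_iff)

lemma is_morphism_eta: "is_morphism A B f \<Longrightarrow> lam (edges A) (app f) = f"
  unfolding is_morphism_def function_from_to_def using function_eta by metis

lemma is_morphism_id: "is_monograph A \<Longrightarrow> is_morphism A A (lam (edges A) (\<lambda>x. x))"
  by (auto simp: is_morphism_def function_from_to_def nth_edge_in_edges)

lemma is_morphism_comp:
  assumes "is_monograph A" "is_morphism A B f" "is_morphism B C g"
  shows "is_morphism A C (lam (edges A) (\<lambda>x. app g (app f x)))"
  using assms by (auto simp: is_morphism_def function_from_to_def nth_edge_in_edges)

lemma is_category_Monogr: "is_category Monogr"
proof -
  have app_edge: "app f x \<in> elts (edges B)" if "is_morphism A B f" "x \<in> elts (edges A)"
    for A B f x :: 'a
    using that by (auto simp: is_morphism_def function_from_to_def)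
  have unit: "lam (edges A) (\<lambda>x. app f (app (lam (edges A) (\<lambda>x. x)) x)) = f"
    "lam (edges A) (\<lambda>x. app (lam (edges B) (\<lambda>x. x)) (app f x)) = f"
    if "is_morphism A B f" for A B f :: 'a
    using is_morphism_eta[OF that] app_edge[OF that]
    by (simp_all cong: lam_cong)
  have assoc: "lam (edges A) (\<lambda>x. app h (app (lam (edges A) (\<lambda>x. app g (app f x))) x)) =
      lam (edges A) (\<lambda>x. app (lam (edges B) (\<lambda>x. app h (app g x))) (app f x))"
    if "is_morphism A B f" for A B f g h :: 'a
    by (rule lam_cong) (simp add: app_edge[OF that])
  show ?thesis
    unfolding is_category_def hom_def Monogr_def
    by (auto simp: is_morphism_id is_morphism_comp unit assoc)
qed

lemma is_category_SMonogr: "is_category SMonogr"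
  and is_category_SMonogr_in: "is_category (SMonogr_in S)"
  and is_category_FMonogr: "is_category FMonogr"
  unfolding SMonogr_def SMonogr_in_def FMonogr_def
  by (simp_all add: is_category_full_subcategory is_category_Monogr)

end

theory Submission
  imports Defs "HOL-Library.FuncSet"
begin

text \<open>
  In the category of standard \<open>O\<close>-monographs a finite limit is the set of pairs of a length
  \<open>\<lambda> \<in> O\<close> and a compatible family of edges, all of length \<open>\<lambda>\<close>; recording the length separately
  makes this work for the empty diagram too. In the other three categories there is no terminal
  object: some object has an edge of length \<open>\<lambda>\<close>, for every ordinal \<open>\<lambda>\<close> (respectively every
  \<open>\<lambda> < \<omega>\<close>), so a terminal object would have edges of all these lengths. This contradicts the
  Burali-Forti paradox (respectively finiteness).
\<close>

section \<open>Coding classes of HOL objects by sets of the universe\<close>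

section \<open>Small classes\<close>

text \<open>Families of edges are HOL functions, not elements of \<open>'v\<close>; the coding
  \<open>c\<close> replaces them by distinct sets.\<close>

definition small_via :: "('b \<Rightarrow> 'v::set_universe) \<Rightarrow> 'b set \<Rightarrow> bool" where
  "small_via c X \<longleftrightarrow> inj_on c X \<and> c ` X \<in> range elts"

lemma small_via_subset:
  assumes "small_via c X" "Y \<subseteq> X"
  shows "small_via c Y"
proof -
  obtain z where z: "c ` X = elts z" using assms(1) by (auto simp: small_via_def)
  have "c ` Y \<subseteq> elts z" using assms(2) z by auto
  then show ?thesis
    using assms separation inj_on_subset by (auto simp: small_via_def)
qed

lemma small_via_elts: "small_via (\<lambda>x. x) (elts x)"
  by (simp add: small_via_def)

lemma small_via_bij_betw:
  assumes "small_via c Y" "bij_betw f X Y"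
  shows "small_via (c \<circ> f) X"
  using assms unfolding small_via_def bij_betw_def by (metis comp_inj_on image_comp)

lemma UN_in_range:
  assumes "X \<in> range (elts :: 'v::set_universe \<Rightarrow> 'v set)" "\<And>x. x \<in> X \<Longrightarrow> F x \<in> range elts"
  shows "(\<Union>x\<in>X. F x) \<in> range (elts :: 'v \<Rightarrow> 'v set)"
proof -
  obtain a where a: "X = elts a" using assms(1) by auto
  obtain b where b: "elts b = (\<lambda>x. mkset (F x)) ` elts a" using replacement by (metis rangeE)
  have "(\<Union>x\<in>X. F x) = (\<Union>y\<in>elts b. elts y)"
    using assms(2) by (simp add: a b elts_mkset)
  then show ?thesis using union by metis
qed

text \<open>With no power set to bound it, the product is built as the union of its slices, each a
  set by replacement.\<close>

lemma small_via_Times: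
  fixes c :: "'a \<Rightarrow> 'v::set_universe"
  assumes "small_via c X" "small_via d Y"
  shows "small_via (\<lambda>(x, y). opair (c x) (d y)) (X \<times> Y)"
proof -
  obtain b where b: "d ` Y = elts b" using assms(2) by (auto simp: small_via_def)
  have "(\<Union>x\<in>c ` X. opair x ` elts b) \<in> range elts"
    by (rule UN_in_range) (use assms(1) replacement in \<open>auto simp: small_via_def\<close>)
  also have "(\<Union>x\<in>c ` X. opair x ` elts b) = (\<lambda>(x, y). opair (c x) (d y)) ` (X \<times> Y)"
    unfolding b[symmetric] by force
  finally show ?thesis
    using assms by (auto simp: small_via_def inj_on_def)
qed

text \<open>Induction on \<open>I\<close>: a function on \<open>insert i I\<close> amounts to a
  value at \<open>i\<close> and a function on \<open>I\<close>. Infinite products can be proper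
  classes, as happens for the hereditarily countable sets.\<close>

lemma small_via_PiE:
  fixes E :: "'i \<Rightarrow> 'v::set_universe"
  assumes "finite I"
  shows "\<exists>c :: ('i \<Rightarrow> 'v) \<Rightarrow> 'v. small_via c (PiE I (\<lambda>i. elts (E i)))"
  using assms
proof (induction I rule: finite_induct)
  case empty
  have "{mkset {} :: 'v} \<in> range elts" using pair_in_range[of "mkset {} :: 'v" "mkset {}"] by simp
  then have "small_via (\<lambda>_ :: 'i \<Rightarrow> 'v. mkset {} :: 'v) {\<lambda>_. undefined}"
    by (simp add: small_via_def)
  then show ?case unfolding PiE_empty_domain by blast
next
  case (insert i I)
  then obtain c :: "('i \<Rightarrow> 'v) \<Rightarrow> 'v" where c: "small_via c (PiE I (\<lambda>i. elts (E i)))" by auto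
  let ?g = "\<lambda>(y, g). g(i := y)" and ?D = "elts (E i) \<times> PiE I (\<lambda>i. elts (E i))"
  have "bij_betw ?g ?D (PiE (insert i I) (\<lambda>i. elts (E i)))"
    unfolding bij_betw_def
    using inj_combinator[OF insert.hyps(2), of "\<lambda>i. elts (E i)"] by (simp add: PiE_insert_eq)
  \<comment> \<open>Codings are pulled back along bijections, hence the inverse.\<close>
  then have "bij_betw (inv_into ?D ?g) (PiE (insert i I) (\<lambda>i. elts (E i))) ?D"
    by (rule bij_betw_inv_into)
  with small_via_bij_betw[OF small_via_Times[OF small_via_elts c]] show ?case by blast
qed


section \<open>Building monographs from coded data; arrows as pointwise maps\<close>

section \<open>Monographs and their morphisms\<close>

lemma elts_numeral_0 [simp]: "elts (numeral_set 0 :: 'v::set_universe) = {}"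
  by simp

lemma elts_eq_empty: "elts x = {} \<longleftrightarrow> x = (numeral_set 0 :: 'v::set_universe)"
  using extensionality elts_numeral_0 by metis

text \<open>Turns edges given by any HOL type into a genuine monograph by coding them; this yields
  both the limits and the test objects below.\<close>

lemma exists_monograph:
  fixes lng :: "'b \<Rightarrow> 'v::set_universe"
  assumes c: "small_via c E"
    and ord: "\<And>y. y \<in> E \<Longrightarrow> is_ordinal (lng y)"
    and s: "\<And>y \<iota>. y \<in> E \<Longrightarrow> \<iota> \<in> elts (lng y) \<Longrightarrow> s y \<iota> \<in> E"
  obtains A where "is_monograph A" "elts (edges A) = c ` E"
    "\<And>y. y \<in> E \<Longrightarrow> len A (c y) = lng y"
    "\<And>y \<iota>. y \<in> E \<Longrightarrow> \<iota> \<in> elts (lng y) \<Longrightarrow> nth_edge A (c y) \<iota> = c (s y \<iota>)"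
proof -
  obtain e where e: "elts e = c ` E" using c by (auto simp: small_via_def)
  define d where "d = inv_into E c"
  have d: "d (c y) = y" if "y \<in> E" for y
    using c that by (simp add: d_def small_via_def)
  define A where "A = lam e (\<lambda>z. lam (lng (d z)) (\<lambda>\<iota>. c (s (d z) \<iota>)))"
  have dom: "dom_set A = e" by (simp add: A_def)
  have app: "app A (c y) = lam (lng y) (\<lambda>\<iota>. c (s y \<iota>))" if "y \<in> E" for y
    using that by (simp add: A_def e d)
  show ?thesis
  proof (rule that)
    show "is_monograph A"
      unfolding is_monograph_def is_sequence_def function_from_to_def dom
      \<comment> \<open>Putting the definition under \<open>is_function\<close> unfolds
        \<open>A\<close> only there, so that the rule \<open>app\<close> still matches
        elsewhere.\<close>
      by (auto simp: e app ord s A_def[THEN arg_cong[where f = is_function]])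
    show "elts (edges A) = c ` E" by (simp add: edges_def dom e)
    show "len A (c y) = lng y" if "y \<in> E" for y by (simp add: len_def app that)
    show "nth_edge A (c y) \<iota> = c (s y \<iota>)" if "y \<in> E" "\<iota> \<in> elts (lng y)" for y \<iota>
      by (simp add: nth_edge_def app that)
  qed
qed

lemma is_morphism_lam:
  assumes "\<And>x. x \<in> elts (edges A) \<Longrightarrow> h x \<in> elts (edges B)"
    and "\<And>x. x \<in> elts (edges A) \<Longrightarrow> len B (h x) = len A x"
    and "\<And>x \<iota>. x \<in> elts (edges A) \<Longrightarrow> \<iota> \<in> elts (len A x) \<Longrightarrow> h (nth_edge A x \<iota>) = nth_edge B (h x) \<iota>"
    and "is_monograph A"
  shows "is_morphism A B (lam (edges A) h)"
  using assms by (auto simp: is_morphism_def function_from_to_def nth_edge_in_edges)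

lemma is_morphismD:
  assumes "is_morphism A B f" "x \<in> elts (edges A)"
  shows "app f x \<in> elts (edges B)" "len B (app f x) = len A x"
    "\<iota> \<in> elts (len A x) \<Longrightarrow> app f (nth_edge A x \<iota>) = nth_edge B (app f x) \<iota>"
  using assms by (auto simp: is_morphism_def function_from_to_def)

lemma lam_eq_iff: "lam X h = lam X k \<longleftrightarrow> (\<forall>x\<in>elts X. h x = k x)"
  by (metis app_lam lam_cong)

text \<open>A morphism is the graph of its own values, so equations between arrows can be checked
  edge by edge.\<close>

lemma lam_eq_morphism_iff:
  "is_morphism A B f \<Longrightarrow> lam (edges A) h = f \<longleftrightarrow> (\<forall>x\<in>elts (edges A). h x = app f x)"
  using lam_eq_iff is_morphism_eta by metis

lemma Obj_full_subcategory_Monogr: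
  "A \<in> Obj (full_subcategory Monogr P) \<longleftrightarrow> is_monograph A \<and> P A"
  by (simp add: full_subcategory_def Monogr_def)

lemma hom_full_subcategory_Monogr:
  "hom (full_subcategory Monogr P) A B =
     {(A, f, B) | f. is_monograph A \<and> is_monograph B \<and> P A \<and> P B \<and> is_morphism A B f}"
  by (auto simp: full_subcategory_def Monogr_def hom_def)

lemma Comp_full_subcategory_Monogr:
  "Comp (full_subcategory Monogr P) (B', g, C) (A, f, B) =
     (A, lam (edges A) (\<lambda>x. app g (app f x)), C)"
  by (simp add: full_subcategory_def Monogr_def)


section \<open>Construction of limits and their universal property\<close>

section \<open>Finite limits of standard monographs\<close>

text \<open>An edge either has length 0 or has an entry, which is a node by standardness.\<close>

lemma zero_in_lengths:
  fixes S :: "'v::set_universe"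
  assumes "is_standard A" "lengths_in S A" "x \<in> elts (edges A)"
  shows "numeral_set 0 \<in> elts S"
proof (cases "len A x = numeral_set 0")
  case True
  then show ?thesis using assms by (metis lengths_in_def)
next
  case False
  then obtain \<iota> where "\<iota> \<in> elts (len A x)" using elts_eq_empty by blast
  then have "is_node A (nth_edge A x \<iota>)" using assms by (simp add: is_standard_def)
  then show ?thesis using assms(2) by (metis is_node_def lengths_in_def)
qed

text \<open>Standardness closes the construction: entries are taken componentwise, and being nodes
  they share the length 0, so they form a compatible family again.\<close>

lemma finitely_complete_SMonogr_in:
  fixes S :: "'v::set_universe"
  assumes S: "\<And>\<alpha>. \<alpha> \<in> elts S \<Longrightarrow> is_ordinal \<alpha>"
  shows "finitely_complete (SMonogr_in S)"
  unfolding finitely_complete_def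
proof (intro allI impI, elim conjE)
  fix J :: "(nat, nat) category" and Fo :: "nat \<Rightarrow> 'v" and Fm
  assume J: "is_category J" "finite (Obj J)" and F: "is_functor J (SMonogr_in S) Fo Fm"
  let ?C = "SMonogr_in S" and ?z = "numeral_set 0 :: 'v"
  note Obj_C = Obj_full_subcategory_Monogr[where P = "\<lambda>A. is_standard A \<and> lengths_in S A", folded SMonogr_in_def]
    and hom_C = hom_full_subcategory_Monogr[where P = "\<lambda>A. is_standard A \<and> lengths_in S A", folded SMonogr_in_def]
    and Comp_C = Comp_full_subcategory_Monogr[where P = "\<lambda>A. is_standard A \<and> lengths_in S A", folded SMonogr_in_def]
  have J_obj: "Dom J u \<in> Obj J" "Cod J u \<in> Obj J" if "u \<in> Arr J" for u
    using J(1) that by (auto simp: is_category_def)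
  have Fo: "is_monograph (Fo i)" "is_standard (Fo i)" "lengths_in S (Fo i)" if "i \<in> Obj J" for i
    using F that by (auto simp: is_functor_def Obj_C)
  define \<phi> where "\<phi> u = fst (snd (Fm u))" for u
  have Fm: "Fm u = (Fo (Dom J u), \<phi> u, Fo (Cod J u))"
    and \<phi>: "is_morphism (Fo (Dom J u)) (Fo (Cod J u)) (\<phi> u)" if "u \<in> Arr J" for u
    using F that by (force simp: is_functor_def hom_C \<phi>_def)+

  define D where "D = PiE (Obj J) (\<lambda>i. elts (edges (Fo i)))"
  \<comment> \<open>The condition \<open>0 \<in> S\<close> matters only for the empty diagram: without nodes,
    standard monographs are empty.\<close>
  define E where "E = {(l, x). ?z \<in> elts S \<and> l \<in> elts S \<and> x \<in> D \<and>
    (\<forall>i\<in>Obj J. len (Fo i) (x i) = l) \<and>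
    (\<forall>u\<in>Arr J. app (\<phi> u) (x (Dom J u)) = x (Cod J u))}"
  \<comment> \<open>The recorded length is 0 because every entry is a node.\<close>
  define s where "s = (\<lambda>(l :: 'v, x) \<iota>. (?z, \<lambda>i\<in>Obj J. nth_edge (Fo i) (x i) \<iota>))"
  obtain c' :: "(nat \<Rightarrow> 'v) \<Rightarrow> 'v" where "small_via c' D"
    using small_via_PiE[OF J(2), of "\<lambda>i. edges (Fo i)"] unfolding D_def by blast
  \<comment> \<open>\<open>E\<close> is part of the product of \<open>elts S\<close> and
    \<open>D\<close>; here it matters that the admissible lengths form a set.\<close>
  from small_via_subset[OF small_via_Times[OF small_via_elts this], of E S]
  obtain c :: "'v \<times> (nat \<Rightarrow> 'v) \<Rightarrow> 'v" where c: "small_via c E" by (fastforce simp: E_def)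
  have xE: "x i \<in> elts (edges (Fo i))" "len (Fo i) (x i) = l" if "(l, x) \<in> E" "i \<in> Obj J" for l x i
    using that by (auto simp: E_def D_def)
  have sE: "s y \<iota> \<in> E" if y: "y \<in> E" "\<iota> \<in> elts (fst y)" for y \<iota>
  proof -
    obtain l x where lx: "y = (l, x)" by force
    have node: "is_node (Fo i) (nth_edge (Fo i) (x i) \<iota>)" if "i \<in> Obj J" for i
      using xE[of l x i] Fo(2)[of i] y that by (auto simp: lx is_standard_def)
    \<comment> \<open>Morphisms commute with taking entries, so compatibility passes from
      \<open>x\<close> to its entries.\<close>
    have "app (\<phi> u) (nth_edge (Fo (Dom J u)) (x (Dom J u)) \<iota>) =
        nth_edge (Fo (Cod J u)) (x (Cod J u)) \<iota>" if u: "u \<in> Arr J" for u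
      using is_morphismD(3)[OF \<phi>[OF u], of "x (Dom J u)" \<iota>] xE[of l x "Dom J u"] J_obj[OF u] y u
      by (auto simp: lx E_def)
    then show ?thesis
      using y node J_obj by (auto simp: lx s_def E_def D_def is_node_def simp del: numeral_set.simps)
  qed
  obtain L where L: "is_monograph L" "elts (edges L) = c ` E"
    "\<And>y. y \<in> E \<Longrightarrow> len L (c y) = fst y"
    "\<And>y \<iota>. y \<in> E \<Longrightarrow> \<iota> \<in> elts (fst y) \<Longrightarrow> nth_edge L (c y) \<iota> = c (s y \<iota>)"
    by (rule exists_monograph[OF c, of fst s]) (use sE S in \<open>auto simp: E_def\<close>)
  have "is_standard L"
    using L sE by (auto simp: is_standard_def is_node_def s_def simp del: numeral_set.simps)
  moreover have "lengths_in S L" using L by (auto simp: lengths_in_def E_def)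
  ultimately have L_Obj: "L \<in> Obj ?C" by (simp add: Obj_C L)
  define d where "d = inv_into E c"
  have d: "d (c y) = y" if "y \<in> E" for y
    using c that by (simp add: d_def small_via_def)
  define \<pi> where "\<pi> i = lam (edges L) (\<lambda>z. snd (d z) i)" for i
  have \<pi>: "app (\<pi> i) (c y) = snd y i" if "y \<in> E" for i y
    using that by (simp add: \<pi>_def L d)
  have \<pi>_mor: "is_morphism L (Fo i) (\<pi> i)" if "i \<in> Obj J" for i
    unfolding \<pi>_def
    by (rule is_morphism_lam) (use xE L sE that in \<open>auto simp: d s_def simp del: numeral_set.simps\<close>)
  define p where "p i = (L, \<pi> i, Fo i)" for i

  have "is_cone J ?C Fo Fm L p"
    unfolding is_cone_def
  proof (intro conjI ballI)
    show "p i \<in> hom ?C L (Fo i)" if "i \<in> Obj J" for i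
      using L_Obj that Fo \<pi>_mor by (auto simp: hom_C p_def Obj_C)
    show "Comp ?C (Fm u) (p (Dom J u)) = p (Cod J u)" if "u \<in> Arr J" for u
      using that J_obj[OF that]
      by (auto simp: Fm p_def Comp_C lam_eq_morphism_iff[OF \<pi>_mor] L \<pi> E_def)
  qed (rule L_Obj)
  moreover have "\<exists>!h. h \<in> hom ?C L' L \<and> (\<forall>i\<in>Obj J. Comp ?C (p i) h = p' i)"
    if cone: "is_cone J ?C Fo Fm L' p'" for L' p'
  proof -
    have L': "is_monograph L'" "is_standard L'" "lengths_in S L'"
      using cone by (auto simp: is_cone_def Obj_C)
    define q where "q i = fst (snd (p' i))" for i
    have p': "p' i = (L', q i, Fo i)" and q: "is_morphism L' (Fo i) (q i)" if "i \<in> Obj J" for i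
      using cone that by (force simp: is_cone_def hom_C q_def)+
    have compat: "app (\<phi> u) (app (q (Dom J u)) y) = app (q (Cod J u)) y"
      if "u \<in> Arr J" "y \<in> elts (edges L')" for u y
    proof -
      have "Comp ?C (Fm u) (p' (Dom J u)) = p' (Cod J u)"
        using cone that by (simp add: is_cone_def)
      then show ?thesis
        using that by (simp add: Fm p' J_obj Comp_C lam_eq_morphism_iff[OF q])
    qed
    \<comment> \<open>The mediating map before coding. The length is read off in \<open>L'\<close>,
      since an empty diagram has no component to supply it.\<close>
    define k where "k y = (len L' y, \<lambda>i\<in>Obj J. app (q i) y)" for y
    have kE: "k y \<in> E" if y: "y \<in> elts (edges L')" for y
    proof -
      have "len L' y \<in> elts S" using y L' by (simp add: lengths_in_def)
      then show ?thesis
        using y zero_in_lengths[OF L'(2,3) y] is_morphismD[OF q _] compat J_obj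
        by (auto simp: k_def E_def D_def simp del: numeral_set.simps)
    qed
    have k_nth: "k (nth_edge L' y \<iota>) = s (k y) \<iota>"
      if "y \<in> elts (edges L')" "\<iota> \<in> elts (len L' y)" for y \<iota>
      using L' that is_morphismD(3)[OF q]
      by (auto simp: k_def s_def is_standard_def is_node_def simp del: numeral_set.simps)
    define h where "h = (L', lam (edges L') (\<lambda>y. c (k y)), L)"
    have "is_morphism L' L (lam (edges L') (\<lambda>y. c (k y)))"
      by (rule is_morphism_lam) (use L L' kE k_nth in \<open>auto simp: k_def\<close>)
    then have h_hom: "h \<in> hom ?C L' L" using L' L_Obj by (auto simp: h_def hom_C Obj_C)
    show ?thesis
    proof (rule ex1I[of _ h], intro conjI ballI)
      show "Comp ?C (p i) h = p' i" if "i \<in> Obj J" for i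
        using that by (auto simp: p_def h_def Comp_C p' lam_eq_morphism_iff[OF q] kE \<pi>)
          (simp add: k_def)
      fix g assume g: "g \<in> hom ?C L' L \<and> (\<forall>i\<in>Obj J. Comp ?C (p i) g = p' i)"
      then obtain g' where g': "g = (L', g', L)" "is_morphism L' L g'" by (auto simp: hom_C)
      \<comment> \<open>Uniqueness: length preservation forces \<open>l\<close>, the cone equations
        force \<open>x\<close> on \<open>Obj J\<close>, and extensionality fixes \<open>x\<close>
        elsewhere.\<close>
      have "app g' y = c (k y)" if y: "y \<in> elts (edges L')" for y
      proof -
        obtain l x where lx: "(l, x) \<in> E" "app g' y = c (l, x)"
          using is_morphismD(1)[OF g'(2) y] L(2) by auto
        have "l = len L' y" using is_morphismD(2)[OF g'(2) y] L(3)[OF lx(1)] lx by simp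
        moreover have "x i = app (q i) y" if i: "i \<in> Obj J" for i
        proof -
          have "Comp ?C (p i) g = p' i" using g i by blast
          then have "app (\<pi> i) (app g' y) = app (q i) y"
            using y i by (simp add: p_def g' Comp_C p' lam_eq_morphism_iff[OF q])
          then show ?thesis by (simp add: lx \<pi>)
        qed
        moreover have "x \<in> extensional (Obj J)"
          using lx(1) unfolding E_def D_def PiE_def by blast
        ultimately have "l = len L' y" "x = (\<lambda>i\<in>Obj J. app (q i) y)"
          by (auto intro: extensionalityI)
        then show ?thesis by (simp add: lx(2) k_def)
      qed
      then have "lam (edges L') (\<lambda>y. c (k y)) = g'" by (simp add: lam_eq_morphism_iff[OF g'(2)])
      then show "g = h" by (simp add: g' h_def)
    qed (rule h_hom)
  qed
  ultimately show "\<exists>L p. is_limit J ?C Fo Fm L p" unfolding is_limit_def by blast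
qed


section \<open>Transitive sets of transitive sets, numerals and Burali-Forti\<close>

section \<open>Ordinals\<close>

text \<open>Von Neumann ordinals as transitive sets of transitive sets: under foundation this avoids
  handling well-orders explicitly.\<close>

definition hereditarily_transitive :: "'v::set_universe \<Rightarrow> bool" where
  "hereditarily_transitive \<alpha> \<longleftrightarrow>
     (\<forall>\<beta>\<in>elts \<alpha>. elts \<beta> \<subseteq> elts \<alpha>) \<and> (\<forall>\<beta>\<in>elts \<alpha>. \<forall>\<gamma>\<in>elts \<beta>. elts \<gamma> \<subseteq> elts \<beta>)"

lemma not_mem_self: "(x :: 'v::set_universe) \<notin> elts x"
  using wf_not_refl[OF foundation, of x] by simp

lemma hereditarily_transitive_elts:
  "hereditarily_transitive \<alpha> \<Longrightarrow> \<beta> \<in> elts \<alpha> \<Longrightarrow> hereditarily_transitive \<beta>"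
  unfolding hereditarily_transitive_def by blast

text \<open>Double induction on membership. If \<alpha> and \<beta> were incomparable, the induction
  hypotheses and transitivity would put each element of one into the other, making them
  equal.\<close>

lemma hereditarily_transitive_linear:
  fixes \<alpha> \<beta> :: "'v::set_universe"
  assumes "hereditarily_transitive \<alpha>" "hereditarily_transitive \<beta>"
  shows "\<alpha> \<in> elts \<beta> \<or> \<alpha> = \<beta> \<or> \<beta> \<in> elts \<alpha>"
  using assms
proof (induction \<alpha> arbitrary: \<beta> rule: wf_induct_rule[OF foundation])
  case (1 \<alpha>)
  note IH\<alpha> = 1
  from IH\<alpha>(3) show ?case
  proof (induction \<beta> rule: wf_induct_rule[OF foundation])
    case (1 \<beta>)
    show ?case
    proof (rule ccontr)
      assume n: "\<not> ?thesis"
      have trans: "elts \<gamma> \<subseteq> elts \<delta>" if "hereditarily_transitive \<delta>" "\<gamma> \<in> elts \<delta>" for \<gamma> \<delta> :: 'v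
        using that unfolding hereditarily_transitive_def by blast
      have "\<gamma> \<in> elts \<beta>" if "\<gamma> \<in> elts \<alpha>" for \<gamma>
        using IH\<alpha>(1)[of \<gamma> \<beta>] hereditarily_transitive_elts[OF IH\<alpha>(2)] trans[OF IH\<alpha>(2)] 1(2) n that
        by auto
      moreover have "\<gamma> \<in> elts \<alpha>" if "\<gamma> \<in> elts \<beta>" for \<gamma>
        using 1(1)[of \<gamma>] hereditarily_transitive_elts[OF 1(2)] trans[OF 1(2)] n that by auto
      ultimately have "elts \<alpha> = elts \<beta>" by blast
      then show False using n extensionality by blast
    qed
  qed
qed

text \<open>Totality is the previous lemma; antisymmetry holds since a membership cycle would give a
  self-membership; foundation gives well-foundedness.\<close>

lemma is_ordinal_hereditarily_transitive:
  fixes \<alpha> :: "'v::set_universe"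
  assumes \<alpha>: "hereditarily_transitive \<alpha>"
  shows "is_ordinal \<alpha>"
proof -
  let ?r = "{(\<beta>, \<gamma>). \<beta> \<in> elts \<alpha> \<and> \<gamma> \<in> elts \<alpha> \<and> (\<beta> \<in> elts \<gamma> \<or> \<beta> = \<gamma>)}"
  have tr: "elts \<gamma> \<subseteq> elts \<beta>" if "\<beta> \<in> elts \<alpha>" "\<gamma> \<in> elts \<beta>" for \<beta> \<gamma>
    using \<alpha> that unfolding hereditarily_transitive_def by blast
  have "refl_on (elts \<alpha>) ?r" by (auto simp: refl_on_def)
  moreover have "?r \<subseteq> elts \<alpha> \<times> elts \<alpha>" by auto
  moreover have "trans ?r" using tr by (auto simp: trans_def)
  moreover have "antisym ?r" using tr not_mem_self by (auto simp: antisym_def)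
  moreover have "total_on (elts \<alpha>) ?r"
    using hereditarily_transitive_linear hereditarily_transitive_elts[OF \<alpha>]
    by (auto simp: total_on_def)
  moreover have "wf (?r - Id)" by (rule wf_subset[OF foundation]) auto
  ultimately show ?thesis
    using \<alpha>
    unfolding is_ordinal_def well_order_on_def linear_order_on_def partial_order_on_def
      preorder_on_def hereditarily_transitive_def by blast
qed

lemma elts_numeral_set:
  "elts (numeral_set n :: 'v::set_universe) = numeral_set ` {..<n}"
proof (induction n)
  case (Suc n)
  \<comment> \<open>\<open>mkset\<close> is meaningful only on sets. Truncating at \<open>n\<close>
    makes the finite segment a range over \<open>nat\<close>, to which \<open>infinity\<close>
    applies.\<close>
  let ?f = "\<lambda>m. numeral_set (min m n) :: 'v"
  have "range ?f = numeral_set ` {..<Suc n}"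
  proof
    show "numeral_set ` {..<Suc n} \<subseteq> range ?f"
    proof
      fix x assume "x \<in> (numeral_set ` {..<Suc n} :: 'v set)"
      then obtain m where "m \<le> n" "x = numeral_set m" by (auto simp: less_Suc_eq_le)
      then have "x = ?f m" by (simp add: min_def)
      then show "x \<in> range ?f" by blast
    qed
  qed auto
  then have "numeral_set ` {..<Suc n} \<in> range (elts :: 'v \<Rightarrow> 'v set)" using infinity by metis
  moreover have "numeral_set ` {..<Suc n} = insert (numeral_set n) (elts (numeral_set n :: 'v))"
    by (simp add: Suc lessThan_Suc)
  ultimately show ?case by (simp add: elts_mkset)
qed simp

lemma hereditarily_transitive_numeral_set:
  "hereditarily_transitive (numeral_set n :: 'v::set_universe)"
  by (force simp: hereditarily_transitive_def elts_numeral_set)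

lemma inj_numeral_set: "inj (numeral_set :: nat \<Rightarrow> 'v::set_universe)"
proof (rule linorder_injI)
  fix m n :: nat assume "m < n"
  then have "(numeral_set m :: 'v) \<in> elts (numeral_set n)" by (simp add: elts_numeral_set)
  then show "(numeral_set m :: 'v) \<noteq> numeral_set n" using not_mem_self by metis
qed

lemma elts_omega: "elts (omega :: 'v::set_universe) = range numeral_set"
  unfolding omega_def by (rule elts_mkset[OF infinity])

text \<open>Otherwise separation collects all such \<alpha> into a set \<open>w\<close>, which is
  hereditarily transitive itself and hence its own element.\<close>

lemma Burali_Forti:
  fixes z :: "'v::set_universe"
  shows "\<exists>\<alpha>. hereditarily_transitive \<alpha> \<and> \<alpha> \<notin> elts z"
proof (rule ccontr)
  assume "\<not> ?thesis"
  then have "{\<alpha>. hereditarily_transitive \<alpha>} \<subseteq> elts z" by blast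
  from separation[OF this] obtain w :: 'v where w: "elts w = {\<alpha>. hereditarily_transitive \<alpha>}"
    by (metis rangeE)
  have "hereditarily_transitive w"
    unfolding hereditarily_transitive_def[of w] w
    using hereditarily_transitive_elts unfolding hereditarily_transitive_def by blast
  then show False using w not_mem_self by blast
qed


section \<open>Lengths realised in a terminal object, and the contradictions\<close>

section \<open>Absence of terminal objects\<close>

text \<open>A terminal object is a limit of the empty diagram; the existence of arrows into it is
  all that is retained.\<close>

lemma finitely_complete_terminal:
  assumes "finitely_complete C"
  obtains T where "T \<in> Obj C" "\<And>A. A \<in> Obj C \<Longrightarrow> hom C A T \<noteq> {}"
proof -
  define J :: "(nat, nat) category" where
    "J = \<lparr>Obj = {}, Arr = {}, Dom = id, Cod = id, Ide = id, Comp = (\<lambda>_ _. 0)\<rparr>"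
  have J: "Obj J = {}" "Arr J = {}" by (simp_all add: J_def)
  \<comment> \<open>On the empty category any pair of maps is a functor, even
    \<open>undefined\<close>.\<close>
  then obtain T p where T: "is_limit J C undefined undefined T p"
    using assms unfolding finitely_complete_def by (force simp: is_category_def is_functor_def)
  show ?thesis
  proof (rule that)
    show "T \<in> Obj C" using T by (simp add: is_limit_def is_cone_def)
    show "hom C A T \<noteq> {}" if "A \<in> Obj C" for A
      using T that by (auto simp: is_limit_def is_cone_def J)
  qed
qed

lemma exists_monograph_edge_of_length:
  fixes \<alpha> :: "'v::set_universe"
  assumes "is_ordinal \<alpha>"
  obtains A where "is_monograph A" "is_standard A" "finite (elts (edges A))"
    "len A ` elts (edges A) = {numeral_set 0, \<alpha>}"
proof -
  \<comment> \<open>The numerals are just two distinct names: \<open>False\<close> stands for a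
    node, \<open>True\<close> for an edge of length \<alpha> with that node as every entry.\<close>
  define c :: "bool \<Rightarrow> 'v" where "c b = (if b then numeral_set 1 else numeral_set 0)" for b
  have "(numeral_set 0 :: 'v) \<noteq> numeral_set 1" using inj_numeral_set by (metis injD zero_neq_one)
  then have c: "small_via c UNIV"
    using pair_in_range
    by (auto simp: small_via_def c_def inj_on_def UNIV_bool simp del: numeral_set.simps)
  define lng where "lng b = (if b then \<alpha> else numeral_set 0)" for b
  obtain A where A: "is_monograph A" "elts (edges A) = range c"
    "\<And>y. len A (c y) = lng y"
    "\<And>y \<iota>. \<iota> \<in> elts (lng y) \<Longrightarrow> nth_edge A (c y) \<iota> = c False"
    by (rule exists_monograph[OF c, of lng "\<lambda>_ _. False"])
      (use assms is_ordinal_hereditarily_transitive[OF hereditarily_transitive_numeral_set]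
        in \<open>auto simp: lng_def simp del: numeral_set.simps\<close>)
  show ?thesis
  proof (rule that)
    show "is_standard A"
      using A by (auto simp: is_standard_def is_node_def lng_def simp del: numeral_set.simps)
    show "len A ` elts (edges A) = {numeral_set 0, \<alpha>}"
      using A by (simp add: image_image UNIV_bool lng_def del: numeral_set.simps)
  qed (use A in auto)
qed

text \<open>Take \<open>T\<close> terminal: morphisms preserve length, so every length in
  \<open>A\<close> recurs in \<open>T\<close>.\<close>

lemma finitely_complete_lengths:
  fixes P :: "'v::set_universe \<Rightarrow> bool"
  assumes "finitely_complete (full_subcategory Monogr P)"
  obtains T where "is_monograph T" "P T"
    "\<And>A. is_monograph A \<Longrightarrow> P A \<Longrightarrow> len A ` elts (edges A) \<subseteq> len T ` elts (edges T)"
proof -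
  obtain T where T: "T \<in> Obj (full_subcategory Monogr P)"
    "\<And>A. A \<in> Obj (full_subcategory Monogr P) \<Longrightarrow> hom (full_subcategory Monogr P) A T \<noteq> {}"
    using finitely_complete_terminal[OF assms] by blast
  show ?thesis
  proof (rule that)
    fix A assume "is_monograph A" "P A"
    then obtain f where "is_morphism A T f"
      using T(2)[of A]
      by (auto simp: Obj_full_subcategory_Monogr hom_full_subcategory_Monogr)
    then show "len A ` elts (edges A) \<subseteq> len T ` elts (edges T)"
      by (auto simp flip: is_morphismD(2) dest: is_morphismD(1))
  qed (use T(1) in \<open>auto simp: Obj_full_subcategory_Monogr\<close>)
qed

text \<open>The lengths in \<open>T\<close> form a set by replacement and so miss some ordinal. The
  test monographs are standard, so one argument serves \<open>Monogr\<close> and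
  \<open>SMonogr\<close>.\<close>

lemma not_finitely_complete_of_standard:
  fixes P :: "'v::set_universe \<Rightarrow> bool"
  assumes "\<And>A. is_standard A \<Longrightarrow> P A"
  shows "\<not> finitely_complete (full_subcategory Monogr P)"
proof
  assume "finitely_complete (full_subcategory Monogr P)"
  then obtain T where T: "is_monograph T"
    "\<And>A. is_monograph A \<Longrightarrow> P A \<Longrightarrow> len A ` elts (edges A) \<subseteq> len T ` elts (edges T)"
    by (rule finitely_complete_lengths) blast
  obtain z where z: "elts z = len T ` elts (edges T)" using replacement by (metis rangeE)
  obtain \<alpha> where \<alpha>: "hereditarily_transitive \<alpha>" "\<alpha> \<notin> elts z" using Burali_Forti by blast
  obtain A where "is_monograph A" "is_standard A" "len A ` elts (edges A) = {numeral_set 0, \<alpha>}"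
    using exists_monograph_edge_of_length[OF is_ordinal_hereditarily_transitive[OF \<alpha>(1)]] by metis
  then show False using T(2)[of A] assms z \<alpha>(2) by auto
qed

text \<open>All lengths lie in \<open>omega\<close> here, so the contradiction comes from the
  finiteness of \<open>T\<close>: it would realise every numeral as a length.\<close>

lemma not_finitely_complete_FMonogr:
  "\<not> finitely_complete (FMonogr :: ('v::set_universe, 'v \<times> 'v \<times> 'v) category)"
proof
  assume "finitely_complete (FMonogr :: ('v, 'v \<times> 'v \<times> 'v) category)"
  then obtain T :: 'v where T: "finite (elts (edges T))"
    "\<And>A. is_monograph A \<Longrightarrow> finite (elts (edges A)) \<Longrightarrow> lengths_in omega A \<Longrightarrow>
      len A ` elts (edges A) \<subseteq> len T ` elts (edges T)"
    unfolding FMonogr_def by (rule finitely_complete_lengths) blast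
  have "numeral_set n \<in> len T ` elts (edges T)" for n
  proof -
    obtain A :: 'v where A: "is_monograph A" "finite (elts (edges A))"
      "len A ` elts (edges A) = {numeral_set 0, numeral_set n}"
      using exists_monograph_edge_of_length
        [OF is_ordinal_hereditarily_transitive[OF hereditarily_transitive_numeral_set]] by metis
    have "len A ` elts (edges A) \<subseteq> elts omega"
      unfolding A(3) elts_omega by blast
    then have "lengths_in omega A" by (auto simp: lengths_in_def)
    then show ?thesis using T(2)[of A] A by auto
  qed
  then have "finite (range (numeral_set :: nat \<Rightarrow> 'v))"
    by (intro finite_subset[OF _ finite_imageI[OF T(1), of "len T"]]) blast
  then show False using inj_numeral_set finite_imageD by blast
qed

theorem theorem2:
  shows "(\<forall>Os :: 'v::set_universe.
            (\<forall>\<alpha>\<in>elts Os. is_ordinal \<alpha>) \<longrightarrow> finitely_complete (SMonogr_in Os)) \<and>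
         \<not> finitely_complete (Monogr :: ('v, 'v \<times> 'v \<times> 'v) category) \<and>
         \<not> finitely_complete (SMonogr :: ('v, 'v \<times> 'v \<times> 'v) category) \<and>
         \<not> finitely_complete (FMonogr :: ('v, 'v \<times> 'v \<times> 'v) category)"
proof -
  \<comment> \<open>This brings \<open>Monogr\<close> itself under the lemma on full
    subcategories.\<close>
  have "full_subcategory Monogr (\<lambda>_. True) = (Monogr :: ('v, 'v \<times> 'v \<times> 'v) category)"
    by (simp add: full_subcategory_def)
  then have "\<not> finitely_complete (Monogr :: ('v, 'v \<times> 'v \<times> 'v) category)"
    using not_finitely_complete_of_standard[of "\<lambda>_ :: 'v. True"] by simp
  moreover have "\<not> finitely_complete (SMonogr :: ('v, 'v \<times> 'v \<times> 'v) category)"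
    unfolding SMonogr_def by (rule not_finitely_complete_of_standard)
  ultimately show ?thesis
    using finitely_complete_SMonogr_in not_finitely_complete_FMonogr by blast
qed

end
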